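(* Let $n,p\ge 1$ be integers, let $a,b_1,\dots,b_n,c_1,\dots,c_n$ be complex parameters with $a\notin\{1,2,3,\dots\}$ and $c_i\notin\{0,-1,-2,\dots\}$ for all $i$, and let $$\omega(\xi,\eta)=\mathrm{H}_A^{(n,p)}(a,b_1,\dots,b_n;c_1,\dots,c_n;\xi,\eta),\qquad \xi=(\xi_1,\dots,\xi_n),\ \eta=(\eta_1,\dots,\eta_p),$$ on the region $|\xi_1|+\dots+|\xi_n|<1$, where $\mathrm{H}_A^{(n,p)}$ is the confluent hypergeometric function defined in the context. Then $\omega$ satisfies the following system of $n+p$ partial differential equations (subscripts denote partial derivatives): for every $i=1,\dots,n$, $$\xi_i(1-\xi_i)\,\omega_{\xi_i\xi_i}-\xi_i\sum_{j=1,\,j\ne i}^{n}\xi_j\,\omega_{\xi_i\xi_j}+\xi_i\sum_{j=1}^{p}\eta_j\,\omega_{\xi_i\eta_j}+\bigl[c_i-(a+b_i+1)\xi_i\bigr]\omega_{\xi_i}-b_i\sum_{j=1,\,j\ne i}^{n}\xi_j\,\omega_{\xi_j}+b_i\sum_{j=1}^{p}\eta_j\,\omega_{\eta_j}-a b_i\,\omega=0,$$ and for every $j=1,\dots,p$, $$\sum_{l=1}^{p}\eta_l\,\omega_{\eta_l\eta_j}-\sum_{l=1}^{n}\xi_l\,\omega_{\xi_l\eta_j}+(1-a)\,\omega_{\eta_j}+\omega=0.$$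
   Context: The Pochhammer symbol is $(\kappa)_\nu=\Gamma(\kappa+\nu)/\Gamma(\kappa)$; for an integer $l\ge 1$, $(\kappa)_l=\kappa(\kappa+1)\cdots(\kappa+l-1)$, $(\kappa)_0=1$, and $(\kappa)_{-l}=(-1)^l/(1-\kappa)_l$. The confluent hypergeometric function of $n+p$ variables is $$\mathrm{H}_A^{(n,p)}(a,b_1,\dots,b_n;c_1,\dots,c_n;\xi,\eta)=\sum_{m_1,\dots,m_{n+p}=0}^{\infty}\frac{(a)_{m_1+\dots+m_n-m_{n+1}-\dots-m_{n+p}}\,(b_1)_{m_1}\cdots(b_n)_{m_n}}{m_1!\cdots m_{n+p}!\,(c_1)_{m_1}\cdots(c_n)_{m_n}}\,\xi_1^{m_1}\cdots\xi_n^{m_n}\,\eta_1^{m_{n+1}}\cdots\eta_p^{m_{n+p}},$$ for $|\xi_1|+\dots+|\xi_n|<1$ and arbitrary $\eta\in\mathbb{C}^p$. *)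

theory Defs
  imports "HOL-Analysis.Analysis"
begin

text \<open>The Pochhammer symbol with an integer index. The closed form for negative indices is used
  instead of the Gamma quotient, which is undefined in HOL when the base is a pole of Gamma.\<close>

definition pochhammer_int :: "complex \<Rightarrow> int \<Rightarrow> complex" where
  "pochhammer_int \<kappa> l =
     (if l \<ge> 0 then pochhammer \<kappa> (nat l)
      else (-1) ^ nat (- l) / pochhammer (1 - \<kappa>) (nat (- l)))"

text \<open>The index types \<open>'n\<close> and \<open>'p\<close> are finite and nonempty, of cardinality $n$ and $p$.
  In the multi-index \<open>(m, k)\<close>, the component \<open>m\<close> collects $m_1,\dots,m_n$ and \<open>k\<close> collects
  $m_{n+1},\dots,m_{n+p}$.\<close>

definition HA_term ::
  "complex \<Rightarrow> complex ^ 'n \<Rightarrow> complex ^ 'n \<Rightarrow> complex ^ 'n \<Rightarrow> complex ^ 'p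
    \<Rightarrow> ('n::finite \<Rightarrow> nat) \<times> ('p::finite \<Rightarrow> nat) \<Rightarrow> complex" where
  "HA_term a b c \<xi> \<eta> = (\<lambda>(m, k).
     pochhammer_int a (int (\<Sum>i\<in>UNIV. m i) - int (\<Sum>j\<in>UNIV. k j))
       * (\<Prod>i\<in>UNIV. pochhammer (b $ i) (m i))
     / ((\<Prod>i\<in>UNIV. fact (m i)) * (\<Prod>j\<in>UNIV. fact (k j))
         * (\<Prod>i\<in>UNIV. pochhammer (c $ i) (m i)))
     * (\<Prod>i\<in>UNIV. (\<xi> $ i) ^ m i) * (\<Prod>j\<in>UNIV. (\<eta> $ j) ^ k j))"

definition HA ::
  "complex \<Rightarrow> complex ^ 'n \<Rightarrow> complex ^ 'n \<Rightarrow> complex ^ 'n::finite \<Rightarrow> complex ^ 'p::finite \<Rightarrow> complex" where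
  "HA a b c \<xi> \<eta> = (\<Sum>\<^sub>\<infinity>mk\<in>UNIV. HA_term a b c \<xi> \<eta> mk)"

definition vec_upd :: "'a ^ 'n \<Rightarrow> 'n::finite \<Rightarrow> 'a \<Rightarrow> 'a ^ 'n" where
  "vec_upd x i z = (\<chi> r. if r = i then z else x $ r)"

text \<open>Complex partial derivatives in $\xi_i$ and $\eta_j$. As \<^const>\<open>deriv\<close> is total, existence is
  expressed separately.\<close>

definition D\<xi> ::
  "'n \<Rightarrow> (complex ^ 'n::finite \<Rightarrow> complex ^ 'p::finite \<Rightarrow> complex) \<Rightarrow> complex ^ 'n \<Rightarrow> complex ^ 'p \<Rightarrow> complex" where
  "D\<xi> i f \<xi> \<eta> = deriv (\<lambda>z. f (vec_upd \<xi> i z) \<eta>) (\<xi> $ i)"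

definition D\<eta> ::
  "'p \<Rightarrow> (complex ^ 'n::finite \<Rightarrow> complex ^ 'p::finite \<Rightarrow> complex) \<Rightarrow> complex ^ 'n \<Rightarrow> complex ^ 'p \<Rightarrow> complex" where
  "D\<eta> j f \<xi> \<eta> = deriv (\<lambda>z. f \<xi> (vec_upd \<eta> j z)) (\<eta> $ j)"

definition \<xi>_differentiable ::
  "'n \<Rightarrow> (complex ^ 'n::finite \<Rightarrow> complex ^ 'p::finite \<Rightarrow> complex) \<Rightarrow> complex ^ 'n \<Rightarrow> complex ^ 'p \<Rightarrow> bool" where
  "\<xi>_differentiable i f \<xi> \<eta> \<longleftrightarrow> (\<lambda>z. f (vec_upd \<xi> i z) \<eta>) field_differentiable at (\<xi> $ i)"

definition \<eta>_differentiable ::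
  "'p \<Rightarrow> (complex ^ 'n::finite \<Rightarrow> complex ^ 'p::finite \<Rightarrow> complex) \<Rightarrow> complex ^ 'n \<Rightarrow> complex ^ 'p \<Rightarrow> bool" where
  "\<eta>_differentiable j f \<xi> \<eta> \<longleftrightarrow> (\<lambda>z. f \<xi> (vec_upd \<eta> j z)) field_differentiable at (\<eta> $ j)"

definition has_partials_upto_2 ::
  "(complex ^ 'n::finite \<Rightarrow> complex ^ 'p::finite \<Rightarrow> complex) \<Rightarrow> complex ^ 'n \<Rightarrow> complex ^ 'p \<Rightarrow> bool" where
  "has_partials_upto_2 f \<xi> \<eta> \<longleftrightarrow>
     (\<forall>i. \<xi>_differentiable i f \<xi> \<eta>
        \<and> (\<forall>r. \<xi>_differentiable r (D\<xi> i f) \<xi> \<eta>) \<and> (\<forall>j. \<eta>_differentiable j (D\<xi> i f) \<xi> \<eta>)) \<and>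
     (\<forall>j. \<eta>_differentiable j f \<xi> \<eta>
        \<and> (\<forall>i. \<xi>_differentiable i (D\<eta> j f) \<xi> \<eta>) \<and> (\<forall>r. \<eta>_differentiable r (D\<eta> j f) \<xi> \<eta>))"

end

theory Submission
  imports Defs "HOL-Complex_Analysis.Cauchy_Integral_Formula"
begin

text \<open>Write $\omega = \sum_\mu A_\mu x^\mu$ with all $n+p$ variables collected in one point $x$ and
  one multi-index $\mu$. Each differential equation is a two-term recurrence for the coefficients,
  read through the Euler operators $x_q \partial_q$, which multiply the $\mu$-th term by $\mu_q$.

  Put $w(\mu) = m_1 + \dots + m_n - k_1 - \dots - k_p$, the index of the first Pochhammer symbol, and let
  $\theta$ be the operator $\sum_i \xi_i \partial_{\xi_i} - \sum_j \eta_j \partial_{\eta_j}$, which multiplies the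
  $\mu$-th term by $w(\mu)$. From $(a)_{l+1} = (a+l)(a)_l$ for every integer $l$, which is where
  $a \notin \{1,2,\dots\}$ enters, one gets
  $$(\mu_i + c_i)(\mu_i + 1) A_{\mu + e_i} = (\mu_i + b_i)(a + w(\mu)) A_\mu, \qquad
    (a - 1 + w(\mu))(\mu_j + 1) A_{\mu + e_j} = A_\mu$$
  for a coordinate $i$ of $\xi$ and a coordinate $j$ of $\eta$
  (\<open>HA_coeff_rec_Inl\<close>, \<open>HA_coeff_rec_Inr\<close>). Since $(\mu_q + 1) A_{\mu + e_q}$ are the coefficients of
  $\partial_q \omega$, summation turns these into
  $$(\xi_i \partial_{\xi_i} + c_i)\, \omega_{\xi_i} = (\xi_i \partial_{\xi_i} + b_i)(a + \theta)\, \omega, \qquad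
    (a - 1 + \theta)\, \omega_{\eta_j} = \omega,$$
  which are the two families of the system once the products are expanded
  (\<open>HA_series_equation_Inl\<close>, \<open>HA_series_equation_Inr\<close>).

  Two analytic facts justify the summation. A power series that converges on a domain in which
  every coordinate may range over a disc about 0 of radius larger than its modulus can be
  differentiated termwise, and the result converges on the same domain (\<open>mseries_termwise\<close>), so the
  argument can be iterated. And the series for $\omega$ converges where $\sum_i |\xi_i| < 1$
  (\<open>HA_term_summable\<close>): up to factors $t^{|\mu|}$ with $t > 1$ arbitrarily close to 1, the terms are
  bounded by $\frac{(m_1 + \dots + m_n)!}{m_1! \cdots m_n!} |\xi^m| \cdot \frac{|\eta^k|}{k_1! \cdots k_p!}$, and the
  multinomial theorem reduces this to a geometric series times an exponential series.\<close>

section \<open>Monomials and multi-indices\<close>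

definition mpow :: "('q::finite \<Rightarrow> 'b::comm_semiring_1) \<Rightarrow> ('q \<Rightarrow> nat) \<Rightarrow> 'b" where
  "mpow x \<mu> = (\<Prod>q\<in>UNIV. x q ^ \<mu> q)"

definition raise :: "'q \<Rightarrow> ('q \<Rightarrow> nat) \<Rightarrow> 'q \<Rightarrow> nat" where
  "raise q \<mu> = \<mu>(q := Suc (\<mu> q))"

lemma raise_same [simp]: "raise q \<mu> q = Suc (\<mu> q)"
  and raise_other [simp]: "r \<noteq> q \<Longrightarrow> raise q \<mu> r = \<mu> r"
  by (simp_all add: raise_def)

lemma raise_commute: "raise q (raise r \<mu>) = raise r (raise q \<mu>)"
  by (auto simp: raise_def fun_eq_iff)

lemma inj_raise: "inj (raise q)"
proof (rule injI)
  fix \<mu> \<nu> assume e: "raise q \<mu> = raise q \<nu>"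
  have "\<mu> r = \<nu> r" for r
    using fun_cong[OF e, of r] by (cases "r = q") auto
  then show "\<mu> = \<nu>" by auto
qed

lemma range_raise: "range (raise q) = {\<mu>. \<mu> q \<noteq> 0}"
proof (intro equalityI subsetI)
  fix \<mu> :: "'a \<Rightarrow> nat" assume "\<mu> \<in> {\<mu>. \<mu> q \<noteq> 0}"
  then show "\<mu> \<in> range (raise q)"
    by (intro range_eqI[of _ _ "\<mu>(q := \<mu> q - 1)"]) (auto simp: raise_def)
qed auto

lemma sum_raise: "(\<Sum>r\<in>UNIV. raise q \<mu> r) = Suc (\<Sum>r\<in>UNIV. \<mu> r)" for q :: "'q::finite"
proof -
  have "(\<Sum>r\<in>UNIV. raise q \<mu> r) = Suc (\<mu> q) + (\<Sum>r\<in>UNIV-{q}. raise q \<mu> r)"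
    by (simp add: sum.remove[of UNIV q])
  also have "(\<Sum>r\<in>UNIV-{q}. raise q \<mu> r) = (\<Sum>r\<in>UNIV-{q}. \<mu> r)"
    by (intro sum.cong) auto
  finally show ?thesis by (simp add: sum.remove[of UNIV q])
qed

lemma prod_raise:
  fixes q :: "'q::finite"
  shows "(\<Prod>r\<in>UNIV. f r (raise q \<mu> r)) = f q (Suc (\<mu> q)) * (\<Prod>r\<in>UNIV-{q}. f r (\<mu> r))"
proof -
  have "(\<Prod>r\<in>UNIV-{q}. f r (raise q \<mu> r)) = (\<Prod>r\<in>UNIV-{q}. f r (\<mu> r))"
    by (intro prod.cong) auto
  then show ?thesis by (simp add: prod.remove[of UNIV q])
qed

lemma mpow_remove: "mpow x \<mu> = x q ^ \<mu> q * (\<Prod>r\<in>UNIV-{q}. x r ^ \<mu> r)"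
  by (simp add: mpow_def prod.remove[of UNIV q])

lemma mpow_raise: "mpow x (raise q \<mu>) = x q * mpow x \<mu>"
  using prod_raise[of "\<lambda>r. (^) (x r)" q \<mu>] mpow_remove[of x \<mu> q] by (simp add: mpow_def mult.assoc)

lemma mpow_upd: "mpow (x(q := z)) \<mu> = z ^ \<mu> q * (\<Prod>r\<in>UNIV-{q}. x r ^ \<mu> r)"
  by (subst mpow_remove[of _ _ q]) (auto intro!: prod.cong arg_cong2[where f = "(*)"])

section \<open>Multinomial sums\<close>

definition multinom :: "('q::finite \<Rightarrow> nat) \<Rightarrow> real" where
  "multinom \<mu> = fact (\<Sum>q\<in>UNIV. \<mu> q) / (\<Prod>q\<in>UNIV. fact (\<mu> q))"

lemma multinom_pos: "multinom \<mu> > 0"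
  unfolding multinom_def by (intro divide_pos_pos prod_pos) auto

lemma multinom_raise:
  "multinom (raise q \<mu>) * real (Suc (\<mu> q)) = multinom \<mu> * real (Suc (\<Sum>r\<in>UNIV. \<mu> r))"
proof -
  let ?P = "\<Prod>r\<in>UNIV-{q}. fact (\<mu> r) :: real"
  have "(\<Prod>r\<in>UNIV. fact (raise q \<mu> r)) = real (Suc (\<mu> q)) * (fact (\<mu> q) * ?P)"
    using prod_raise[of "\<lambda>_. fact :: nat \<Rightarrow> real" q \<mu>] by (simp add: mult.assoc)
  moreover have "(\<Prod>r\<in>UNIV. fact (\<mu> r)) = fact (\<mu> q) * ?P"
    by (simp add: prod.remove[of UNIV q])
  ultimately show ?thesis
    unfolding multinom_def sum_raise fact_Suc by (simp del: of_nat_Suc)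
qed

lemma finite_multiindices: "finite {\<mu> :: 'q::finite \<Rightarrow> nat. (\<Sum>q\<in>UNIV. \<mu> q) = N}"
proof (rule finite_subset)
  show "{\<mu> :: 'q \<Rightarrow> nat. (\<Sum>q\<in>UNIV. \<mu> q) = N} \<subseteq> Pi\<^sub>E UNIV (\<lambda>_. {..N})"
    by (auto simp: PiE_UNIV_domain intro: member_le_sum)
qed (auto intro: finite_PiE)

text \<open>Induction on the degree. In $(\sum_q x_q) \cdot \sum_{|\nu| = N} \binom{N}{\nu} x^\nu$ the monomial $x^\mu$ with
  $|\mu| = N+1$ arises from $\nu = \mu - e_q$ for each $q$ with $\mu_q > 0$, with coefficient
  $\binom{N+1}{\mu} \mu_q / (N+1)$, and these fractions add up to 1.\<close>

lemma multinomial: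
  fixes x :: "'q::finite \<Rightarrow> real"
  shows "(\<Sum>\<mu> | (\<Sum>q\<in>UNIV. \<mu> q) = N. multinom \<mu> * mpow x \<mu>) = (\<Sum>q\<in>UNIV. x q) ^ N"
proof (induction N)
  case 0
  have "{\<mu> :: 'q \<Rightarrow> nat. (\<Sum>q\<in>UNIV. \<mu> q) = 0} = {\<lambda>_. 0}" by auto
  then show ?case by (simp add: multinom_def mpow_def)
next
  case (Suc N)
  let ?L = "\<lambda>N. {\<mu> :: 'q \<Rightarrow> nat. (\<Sum>q\<in>UNIV. \<mu> q) = N}"
  define h where "h q \<mu> = multinom \<mu> * mpow x \<mu> * real (\<mu> q) / real (Suc N)" for q \<mu>
  have "(\<Sum>q\<in>UNIV. x q) ^ Suc N = (\<Sum>q\<in>UNIV. \<Sum>\<mu>\<in>?L N. multinom \<mu> * mpow x \<mu> * x q)"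
    by (subst sum.swap) (simp flip: Suc.IH sum_distrib_left sum_distrib_right)
  also have "\<dots> = (\<Sum>q\<in>UNIV. \<Sum>\<mu>\<in>?L (Suc N). h q \<mu>)"
  proof (rule sum.cong[OF refl])
    fix q :: 'q
    have "multinom \<mu> * mpow x \<mu> * x q = h q (raise q \<mu>)" if "\<mu> \<in> ?L N" for \<mu>
    proof -
      have "multinom \<mu> = multinom (raise q \<mu>) * real (Suc (\<mu> q)) / real (Suc N)"
        using that by (simp add: multinom_raise del: of_nat_Suc)
      then show ?thesis
        by (simp add: h_def mpow_raise)
    qed
    then have "(\<Sum>\<mu>\<in>?L N. multinom \<mu> * mpow x \<mu> * x q) = (\<Sum>\<mu>\<in>?L N. h q (raise q \<mu>))"
      by (rule sum.cong[OF refl])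
    also have "\<dots> = sum (h q) (raise q ` ?L N)"
      by (subst sum.reindex) (auto intro: inj_on_subset[OF inj_raise])
    also have "\<dots> = sum (h q) (?L (Suc N))"
    proof (rule sum.mono_neutral_left[OF finite_multiindices])
      show "\<forall>\<mu>\<in>?L (Suc N) - raise q ` ?L N. h q \<mu> = 0"
      proof
        fix \<mu> assume \<mu>: "\<mu> \<in> ?L (Suc N) - raise q ` ?L N"
        have "\<mu> q = 0"
        proof (rule ccontr)
          assume "\<mu> q \<noteq> 0"
          then have "\<mu> \<in> range (raise q)" by (simp add: range_raise)
          then obtain \<nu> where "\<mu> = raise q \<nu>" by blast
          with \<mu> show False by (auto simp: sum_raise)
        qed
        then show "h q \<mu> = 0" by (simp add: h_def)
      qed
    qed (auto simp: sum_raise)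
    finally show "(\<Sum>\<mu>\<in>?L N. multinom \<mu> * mpow x \<mu> * x q) = sum (h q) (?L (Suc N))" .
  qed
  also have "\<dots> = (\<Sum>\<mu>\<in>?L (Suc N). multinom \<mu> * mpow x \<mu> * ((\<Sum>q\<in>UNIV. real (\<mu> q)) / real (Suc N)))"
    by (subst sum.swap) (simp add: h_def sum_distrib_left sum_divide_distrib)
  also have "\<dots> = (\<Sum>\<mu>\<in>?L (Suc N). multinom \<mu> * mpow x \<mu>)"
    by (intro sum.cong refl) (simp del: of_nat_sum of_nat_Suc add: of_nat_sum[symmetric])
  finally show ?case ..
qed

text \<open>The weight $w$ allows both $w = 1$ (a geometric series in $\sum_q x_q$) and $w(N) = 1/N!$ (an
  exponential series).\<close>

lemma summable_on_multinomial:
  fixes x :: "'q::finite \<Rightarrow> real" and w :: "nat \<Rightarrow> real"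
  assumes x: "\<And>q. x q \<ge> 0" and w: "\<And>N. w N \<ge> 0"
    and s: "summable (\<lambda>N. w N * (\<Sum>q\<in>UNIV. x q) ^ N)"
  shows "(\<lambda>\<mu>. w (\<Sum>q\<in>UNIV. \<mu> q) * multinom \<mu> * mpow x \<mu>) summable_on UNIV"
proof (rule nonneg_bounded_partial_sums_imp_summable_on)
  let ?f = "\<lambda>\<mu>. w (\<Sum>q\<in>UNIV. \<mu> q) * multinom \<mu> * mpow x \<mu>"
  let ?L = "\<lambda>N. {\<mu> :: 'q \<Rightarrow> nat. (\<Sum>q\<in>UNIV. \<mu> q) = N}"
  show nn: "?f \<mu> \<ge> 0" for \<mu>
    by (intro mult_nonneg_nonneg w less_imp_le[OF multinom_pos]) (auto simp: mpow_def x intro!: prod_nonneg)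
  have "sum ?f F \<le> (\<Sum>N. w N * (\<Sum>q\<in>UNIV. x q) ^ N)" if "finite F" for F
  proof -
    let ?D = "(\<lambda>\<mu>. \<Sum>q\<in>UNIV. \<mu> q) ` F"
    have "sum ?f F \<le> sum ?f (\<Union>N\<in>?D. ?L N)"
      by (rule sum_mono2) (use that nn in \<open>auto simp: finite_multiindices\<close>)
    also have "\<dots> = (\<Sum>N\<in>?D. sum ?f (?L N))"
      by (rule sum.UNION_disjoint) (use that in \<open>auto simp: finite_multiindices\<close>)
    also have "\<dots> = (\<Sum>N\<in>?D. w N * (\<Sum>q\<in>UNIV. x q) ^ N)"
      by (intro sum.cong refl) (simp flip: multinomial add: sum_distrib_left mult_ac)
    also have "\<dots> \<le> (\<Sum>N. w N * (\<Sum>q\<in>UNIV. x q) ^ N)"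
      by (rule sum_le_suminf[OF s]) (use that w x in \<open>auto intro!: mult_nonneg_nonneg zero_le_power sum_nonneg\<close>)
    finally show ?thesis .
  qed
  then show "\<forall>\<^sub>F F in finite_subsets_at_top UNIV. sum ?f F \<le> (\<Sum>N. w N * (\<Sum>q\<in>UNIV. x q) ^ N)"
    by (auto intro!: eventually_finite_subsets_at_top_weakI)
qed

section \<open>Termwise differentiation\<close>

text \<open>The finite partial sums converge uniformly on a disc around $z$ by the Weierstrass M-test, hence
  so do their derivatives. The limit is taken along finite sets of indices, so convergence of
  the derivatives is literally the summability of the derived series.\<close>

lemma has_field_derivative_infsum_powers:
  fixes g :: "'i \<Rightarrow> complex" and t :: "'i \<Rightarrow> nat"
  assumes sum: "(\<lambda>i. norm (g i) * r ^ t i) summable_on UNIV" and z: "norm z < r"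
  obtains D where
    "((\<lambda>w. \<Sum>\<^sub>\<infinity>i. g i * w ^ t i) has_field_derivative D) (at z)"
    "((\<lambda>i. g i * (of_nat (t i) * z ^ (t i - 1))) has_sum D) UNIV"
proof -
  let ?F = "finite_subsets_at_top (UNIV :: 'i set)"
  have ulim: "uniform_limit (cball z (r - norm z)) (\<lambda>I w. \<Sum>i\<in>I. g i * w ^ t i)
      (\<lambda>w. \<Sum>\<^sub>\<infinity>i. g i * w ^ t i) ?F"
  proof (rule Weierstrass_m_test_general[OF _ sum])
    fix i and w assume "w \<in> cball z (r - norm z)"
    then have "norm w \<le> r"
      using norm_triangle_ineq[of z "w - z"] by (simp add: dist_norm norm_minus_commute)
    then show "norm (g i * w ^ t i) \<le> norm (g i) * r ^ t i"
      by (simp add: norm_mult norm_power mult_left_mono power_mono)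
  qed
  obtain g' where g': "\<And>w. w \<in> ball z (r - norm z) \<Longrightarrow>
      ((\<lambda>w. \<Sum>\<^sub>\<infinity>i. g i * w ^ t i) has_field_derivative g' w) (at w) \<and>
      ((\<lambda>I. \<Sum>i\<in>I. g i * (of_nat (t i) * w ^ (t i - 1))) \<longlongrightarrow> g' w) ?F"
  proof (rule has_complex_derivative_uniform_limit[OF _ ulim, of "\<lambda>I w. \<Sum>i\<in>I. g i * (of_nat (t i) * w ^ (t i - 1))"])
    show "\<forall>\<^sub>F I in ?F. continuous_on (cball z (r - norm z)) (\<lambda>w. \<Sum>i\<in>I. g i * w ^ t i) \<and>
        (\<forall>w\<in>ball z (r - norm z). ((\<lambda>w. \<Sum>i\<in>I. g i * w ^ t i) has_field_derivative
            (\<Sum>i\<in>I. g i * (of_nat (t i) * w ^ (t i - 1)))) (at w))"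
      by (intro always_eventually allI conjI ballI) (auto intro!: continuous_intros derivative_eq_intros sum.cong)
  qed (use z in auto)
  have "z \<in> ball z (r - norm z)" using z by simp
  from g'[OF this] show ?thesis
    by (intro that[of "g' z"]) (simp_all add: has_sum_def)
qed

lemma has_sum_finite_sum:
  fixes f :: "'a \<Rightarrow> 'i \<Rightarrow> 'b::{topological_comm_monoid_add}"
  assumes "finite I" "\<And>i. i \<in> I \<Longrightarrow> ((\<lambda>x. f x i) has_sum s i) A"
  shows "((\<lambda>x. \<Sum>i\<in>I. f x i) has_sum (\<Sum>i\<in>I. s i)) A"
  using assms by (induction I rule: finite_induct) (auto intro!: has_sum_add)

lemma has_sum_minus:
  fixes f g :: "'a \<Rightarrow> 'b::topological_ab_group_add"
  assumes "(f has_sum s) A" "(g has_sum t) A"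
  shows "((\<lambda>x. f x - g x) has_sum (s - t)) A"
  using has_sum_add[OF assms(1), of "\<lambda>x. - g x" "- t"] assms(2) by (simp add: has_sum_uminus)

definition mseries :: "(('q::finite \<Rightarrow> nat) \<Rightarrow> complex) \<Rightarrow> ('q \<Rightarrow> complex) \<Rightarrow> complex" where
  "mseries A x = (\<Sum>\<^sub>\<infinity>\<mu>. A \<mu> * mpow x \<mu>)"

definition fderiv :: "'q \<Rightarrow> (('q \<Rightarrow> nat) \<Rightarrow> complex) \<Rightarrow> ('q \<Rightarrow> nat) \<Rightarrow> complex" where
  "fderiv q A \<mu> = of_nat (Suc (\<mu> q)) * A (raise q \<mu>)"

definition converges_on :: "('q::finite \<Rightarrow> complex) set \<Rightarrow> (('q \<Rightarrow> nat) \<Rightarrow> complex) \<Rightarrow> bool" where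
  "converges_on X A \<longleftrightarrow> (\<forall>x\<in>X. (\<lambda>\<mu>. A \<mu> * mpow x \<mu>) summable_on UNIV)"

text \<open>The property of a domain that makes the one-variable lemma above applicable in every coordinate.
  Discs are centred at 0, since it is absolute convergence at modulus \<open>r\<close> that is used.\<close>

definition radially_open :: "('q \<Rightarrow> complex) set \<Rightarrow> bool" where
  "radially_open X \<longleftrightarrow> (\<forall>x\<in>X. \<forall>q. \<exists>r > norm (x q). \<forall>z. norm z \<le> r \<longrightarrow> x(q := z) \<in> X)"

lemma mseries_has_sum:
  "converges_on X A \<Longrightarrow> x \<in> X \<Longrightarrow> ((\<lambda>\<mu>. A \<mu> * mpow x \<mu>) has_sum mseries A x) UNIV"
  by (auto simp: converges_on_def mseries_def)

text \<open>With the other coordinates frozen this is the one-variable lemma for $\mu \mapsto \mu_q$. Its sum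
  $\sum_\mu g_\mu\, \mu_q x_q^{\mu_q - 1}$ yields the derived power series after dropping the terms with
  $\mu_q = 0$ and substituting $\mu + e_q$ for $\mu$, and the Euler operator after multiplying by $x_q$.\<close>

lemma mseries_termwise:
  fixes q :: "'q::finite"
  assumes X: "radially_open X" and A: "converges_on X A" and x: "x \<in> X"
  shows has_field_derivative_mseries:
      "((\<lambda>z. mseries A (x(q := z))) has_field_derivative mseries (fderiv q A) x) (at (x q))"
    and has_sum_fderiv: "((\<lambda>\<mu>. fderiv q A \<mu> * mpow x \<mu>) has_sum mseries (fderiv q A) x) UNIV"
    and has_sum_euler:
      "((\<lambda>\<mu>. of_nat (\<mu> q) * A \<mu> * mpow x \<mu>) has_sum (x q * mseries (fderiv q A) x)) UNIV"
proof -
  define g where "g \<mu> = A \<mu> * (\<Prod>r\<in>UNIV-{q}. x r ^ \<mu> r)" for \<mu>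
  define d where "d \<mu> = g \<mu> * (of_nat (\<mu> q) * x q ^ (\<mu> q - 1))" for \<mu>
  have upd: "A \<mu> * mpow (x(q := z)) \<mu> = g \<mu> * z ^ \<mu> q" for \<mu> z
    by (simp add: g_def mpow_upd)
  obtain r where r: "norm (x q) < r" "\<And>z. norm z \<le> r \<Longrightarrow> x(q := z) \<in> X"
    using X x unfolding radially_open_def by blast
  have r0: "r \<ge> 0" using r(1) norm_ge_zero[of "x q"] by linarith
  have "(\<lambda>\<mu>. A \<mu> * mpow (x(q := of_real r)) \<mu>) summable_on UNIV"
    using A r r0 by (auto simp: converges_on_def)
  then have "(\<lambda>\<mu>. norm (g \<mu>) * r ^ \<mu> q) summable_on UNIV"
    unfolding upd summable_on_iff_abs_summable_on_complex
    using r0 by (simp add: norm_mult norm_power)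
  then obtain D where D: "((\<lambda>w. \<Sum>\<^sub>\<infinity>\<mu>. g \<mu> * w ^ \<mu> q) has_field_derivative D) (at (x q))"
    and "((\<lambda>\<mu>. g \<mu> * (of_nat (\<mu> q) * x q ^ (\<mu> q - 1))) has_sum D) UNIV"
    by (rule has_field_derivative_infsum_powers[OF _ r(1)])
  then have d: "(d has_sum D) UNIV"
    by (simp add: d_def[abs_def])
  have "(d has_sum D) (range (raise q))"
    by (subst has_sum_cong_neutral[where T = UNIV and g = d]) (auto simp: d range_raise d_def)
  then have "(d \<circ> raise q has_sum D) UNIV"
    by (simp add: has_sum_reindex inj_raise)
  moreover have "d \<circ> raise q = (\<lambda>\<mu>. fderiv q A \<mu> * mpow x \<mu>)"
  proof
    fix \<mu>
    have "(\<Prod>r\<in>UNIV-{q}. x r ^ raise q \<mu> r) = (\<Prod>r\<in>UNIV-{q}. x r ^ \<mu> r)"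
      by (intro prod.cong) auto
    then show "(d \<circ> raise q) \<mu> = fderiv q A \<mu> * mpow x \<mu>"
      by (simp add: d_def g_def fderiv_def mpow_remove[of x \<mu> q] mult_ac)
  qed
  ultimately have D': "((\<lambda>\<mu>. fderiv q A \<mu> * mpow x \<mu>) has_sum D) UNIV" by simp
  then have Deq: "D = mseries (fderiv q A) x"
    by (simp add: mseries_def infsumI)
  show "((\<lambda>\<mu>. fderiv q A \<mu> * mpow x \<mu>) has_sum mseries (fderiv q A) x) UNIV"
    using D' Deq by simp
  show "((\<lambda>z. mseries A (x(q := z))) has_field_derivative mseries (fderiv q A) x) (at (x q))"
    using D unfolding mseries_def[of A] upd Deq .
  have "x q * d \<mu> = of_nat (\<mu> q) * A \<mu> * mpow x \<mu>" for \<mu>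
    by (cases "\<mu> q") (auto simp: d_def g_def mpow_remove[of x \<mu> q])
  then show "((\<lambda>\<mu>. of_nat (\<mu> q) * A \<mu> * mpow x \<mu>) has_sum (x q * mseries (fderiv q A) x)) UNIV"
    using has_sum_cmult_right[OF d, of "x q"] by (simp add: Deq)
qed

lemma converges_on_fderiv: "radially_open X \<Longrightarrow> converges_on X A \<Longrightarrow> converges_on X (fderiv q A)"
  using has_sum_fderiv unfolding converges_on_def summable_on_def by blast

lemma fderiv_commute: "fderiv q (fderiv r A) = fderiv r (fderiv q A)"
  by (cases "q = r") (auto simp: fderiv_def fun_eq_iff raise_commute)

section \<open>The weighted Euler operator\<close>

definition weight :: "('n::finite + 'p::finite \<Rightarrow> nat) \<Rightarrow> int" where
  "weight \<mu> = int (\<Sum>i\<in>UNIV. \<mu> (Inl i)) - int (\<Sum>j\<in>UNIV. \<mu> (Inr j))"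

lemma raise_Inl: "(\<lambda>r. raise (Inl i) \<mu> (Inl r)) = raise i (\<lambda>r. \<mu> (Inl r))"
  and raise_Inr: "(\<lambda>r. raise (Inr j) \<mu> (Inr r)) = raise j (\<lambda>r. \<mu> (Inr r))"
  by (auto simp: raise_def)

lemma weight_raise:
  shows "weight (raise (Inl i) \<mu>) = weight \<mu> + 1" and "weight (raise (Inr j) \<mu>) = weight \<mu> - 1"
  unfolding weight_def raise_Inl raise_Inr sum_raise by simp_all

definition euler :: "(('n::finite + 'p::finite \<Rightarrow> nat) \<Rightarrow> complex) \<Rightarrow> ('n + 'p \<Rightarrow> complex) \<Rightarrow> complex" where
  "euler A x = (\<Sum>i\<in>UNIV. x (Inl i) * mseries (fderiv (Inl i) A) x)
     - (\<Sum>j\<in>UNIV. x (Inr j) * mseries (fderiv (Inr j) A) x)"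

lemma has_sum_weight:
  fixes A :: "('n::finite + 'p::finite \<Rightarrow> nat) \<Rightarrow> complex"
  assumes "radially_open X" "converges_on X A" "x \<in> X"
  shows "((\<lambda>\<mu>. (s + of_int (weight \<mu>)) * A \<mu> * mpow x \<mu>) has_sum (s * mseries A x + euler A x)) UNIV"
proof -
  have "((\<lambda>\<mu>. s * (A \<mu> * mpow x \<mu>) + ((\<Sum>i\<in>UNIV. of_nat (\<mu> (Inl i)) * A \<mu> * mpow x \<mu>)
       - (\<Sum>j\<in>UNIV. of_nat (\<mu> (Inr j)) * A \<mu> * mpow x \<mu>))) has_sum (s * mseries A x + euler A x)) UNIV"
    unfolding euler_def
    by (rule has_sum_add[OF has_sum_cmult_right[OF mseries_has_sum[OF assms(2,3)]]
          has_sum_minus[OF has_sum_finite_sum has_sum_finite_sum]])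
       (simp_all add: has_sum_euler[OF assms])
  moreover have "s * (A \<mu> * mpow x \<mu>) + ((\<Sum>i\<in>UNIV. of_nat (\<mu> (Inl i)) * A \<mu> * mpow x \<mu>)
       - (\<Sum>j\<in>UNIV. of_nat (\<mu> (Inr j)) * A \<mu> * mpow x \<mu>))
       = (s + of_int (weight \<mu>)) * A \<mu> * mpow x \<mu>" for \<mu>
    unfolding sum_distrib_right[symmetric] by (simp add: weight_def algebra_simps)
  ultimately show ?thesis by simp
qed

section \<open>Partial derivatives of represented functions\<close>

definition join :: "complex ^ 'n \<Rightarrow> complex ^ 'p \<Rightarrow> 'n::finite + 'p::finite \<Rightarrow> complex" where
  "join \<xi> \<eta> = case_sum (($) \<xi>) (($) \<eta>)"

lemma join_simps [simp]: "join \<xi> \<eta> (Inl i) = \<xi> $ i" "join \<xi> \<eta> (Inr j) = \<eta> $ j"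
  by (simp_all add: join_def)

lemma join_vec_upd:
  "join (vec_upd \<xi> i z) \<eta> = (join \<xi> \<eta>)(Inl i := z)"
  "join \<xi> (vec_upd \<eta> j z) = (join \<xi> \<eta>)(Inr j := z)"
  by (auto simp: join_def vec_upd_def fun_eq_iff split: sum.splits)

text \<open>Equality is required on the whole domain because the derivative of \<open>f\<close> is again represented on
  that domain, which is what allows second derivatives.\<close>

definition represents ::
  "('n::finite + 'p::finite \<Rightarrow> complex) set \<Rightarrow> (('n + 'p \<Rightarrow> nat) \<Rightarrow> complex)
    \<Rightarrow> (complex ^ 'n \<Rightarrow> complex ^ 'p \<Rightarrow> complex) \<Rightarrow> bool" where
  "represents X A f \<longleftrightarrow> (\<forall>\<xi> \<eta>. join \<xi> \<eta> \<in> X \<longrightarrow> f \<xi> \<eta> = mseries A (join \<xi> \<eta>))"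

lemma has_field_derivative_represents:
  fixes X :: "('n::finite + 'p::finite \<Rightarrow> complex) set"
  assumes X: "radially_open X" and A: "converges_on X A" and f: "represents X A f" and x: "join \<xi> \<eta> \<in> X"
  shows "((\<lambda>z. f (vec_upd \<xi> i z) \<eta>) has_field_derivative mseries (fderiv (Inl i) A) (join \<xi> \<eta>))
           (at (\<xi> $ i))"
    and "((\<lambda>z. f \<xi> (vec_upd \<eta> j z)) has_field_derivative mseries (fderiv (Inr j) A) (join \<xi> \<eta>))
           (at (\<eta> $ j))"
proof -
  have near: "\<forall>\<^sub>F z in nhds (join \<xi> \<eta> q). (join \<xi> \<eta>)(q := z) \<in> X" for q
  proof -
    obtain r where r: "norm (join \<xi> \<eta> q) < r" "\<And>z. norm z \<le> r \<Longrightarrow> (join \<xi> \<eta>)(q := z) \<in> X"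
      using X x unfolding radially_open_def by blast
    have "\<forall>\<^sub>F z in nhds (join \<xi> \<eta> q). z \<in> ball 0 r"
      by (rule eventually_nhds_in_open) (use r(1) in auto)
    then show ?thesis
      by (rule eventually_mono) (auto intro: r(2))
  qed
  note D = has_field_derivative_mseries[OF X A x]
  have "\<forall>\<^sub>F z in nhds (\<xi> $ i). f (vec_upd \<xi> i z) \<eta> = mseries A ((join \<xi> \<eta>)(Inl i := z))"
    using near[of "Inl i"] f by (auto simp: represents_def join_vec_upd elim!: eventually_mono)
  then show "((\<lambda>z. f (vec_upd \<xi> i z) \<eta>) has_field_derivative mseries (fderiv (Inl i) A) (join \<xi> \<eta>))
           (at (\<xi> $ i))"
    using D[of "Inl i"] by (simp add: DERIV_cong_ev)
  have "\<forall>\<^sub>F z in nhds (\<eta> $ j). f \<xi> (vec_upd \<eta> j z) = mseries A ((join \<xi> \<eta>)(Inr j := z))"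
    using near[of "Inr j"] f by (auto simp: represents_def join_vec_upd elim!: eventually_mono)
  then show "((\<lambda>z. f \<xi> (vec_upd \<eta> j z)) has_field_derivative mseries (fderiv (Inr j) A) (join \<xi> \<eta>))
           (at (\<eta> $ j))"
    using D[of "Inr j"] by (simp add: DERIV_cong_ev)
qed

lemma represents_D:
  fixes X :: "('n::finite + 'p::finite \<Rightarrow> complex) set"
  assumes "radially_open X" "converges_on X A" "represents X A f"
  shows "represents X (fderiv (Inl i) A) (D\<xi> i f)" and "represents X (fderiv (Inr j) A) (D\<eta> j f)"
  using has_field_derivative_represents[OF assms]
  by (auto simp: represents_def[of _ "fderiv _ _"] D\<xi>_def D\<eta>_def intro!: DERIV_imp_deriv)

lemma represents_differentiable:
  fixes X :: "('n::finite + 'p::finite \<Rightarrow> complex) set"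
  assumes "radially_open X" "converges_on X A" "represents X A f" "join \<xi> \<eta> \<in> X"
  shows "\<xi>_differentiable i f \<xi> \<eta>" and "\<eta>_differentiable j f \<xi> \<eta>"
  using has_field_derivative_represents[OF assms]
  by (auto simp: \<xi>_differentiable_def \<eta>_differentiable_def field_differentiable_def)

lemma represents_partials_upto_2:
  fixes X :: "('n::finite + 'p::finite \<Rightarrow> complex) set"
  assumes "radially_open X" "converges_on X A" "represents X A f" "join \<xi> \<eta> \<in> X"
  shows "has_partials_upto_2 f \<xi> \<eta>"
proof -
  note conv = converges_on_fderiv[OF assms(1,2)]
  note rep = represents_D[OF assms(1-3)]
  show ?thesis
    unfolding has_partials_upto_2_def
    using represents_differentiable[OF assms]
      represents_differentiable[OF assms(1) conv rep(1) assms(4)]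
      represents_differentiable[OF assms(1) conv rep(2) assms(4)]
    by blast
qed

section \<open>The coefficients and their recurrences\<close>

text \<open>For negative indices the recurrence needs that no factor of $(1-a)_n$ vanishes, and this is the
  hypothesis on $a$.\<close>

lemma pochhammer_int_plus_1:
  assumes a: "\<And>k::nat. k \<ge> 1 \<Longrightarrow> a \<noteq> of_nat k"
  shows "pochhammer_int a (l + 1) = (a + of_int l) * pochhammer_int a l"
proof (cases "l \<ge> 0")
  case True
  then show ?thesis
    by (simp add: pochhammer_int_def nat_add_distrib pochhammer_Suc mult.commute)
next
  case False
  then obtain n where n: "l = - int (Suc n)"
    by (metis not_le negD)
  have nz: "pochhammer (1 - a) k \<noteq> 0" for k
    using a by (auto simp: pochhammer_eq_0_iff algebra_simps)
      (metis One_nat_def add.commute le_add1 of_nat_Suc plus_1_eq_Suc)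
  define e where "e = a + of_int l"
  have P: "pochhammer (1 - a) (Suc n) = - (pochhammer (1 - a) n * e)"
    by (simp add: pochhammer_Suc n e_def algebra_simps)
  have "e \<noteq> 0" using nz[of "Suc n"] P by auto
  have "pochhammer_int a l = (-1) ^ Suc n / pochhammer (1 - a) (Suc n)"
    by (simp add: pochhammer_int_def n nat_add_distrib)
  also have "\<dots> = (-1) ^ n / (pochhammer (1 - a) n * e)"
    by (simp add: P)
  finally have "e * pochhammer_int a l = (-1) ^ n / pochhammer (1 - a) n"
    using \<open>e \<noteq> 0\<close> by simp
  moreover have "pochhammer_int a (l + 1) = (-1) ^ n / pochhammer (1 - a) n"
    by (cases n) (simp_all add: pochhammer_int_def n nat_add_distrib)
  ultimately show ?thesis
    by (simp add: e_def)
qed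

definition HA_coeff ::
  "complex \<Rightarrow> complex ^ 'n \<Rightarrow> complex ^ 'n \<Rightarrow> ('n::finite + 'p::finite \<Rightarrow> nat) \<Rightarrow> complex" where
  "HA_coeff a b c \<mu> = pochhammer_int a (weight \<mu>)
     * (\<Prod>i\<in>UNIV. pochhammer (b $ i) (\<mu> (Inl i)) / (fact (\<mu> (Inl i)) * pochhammer (c $ i) (\<mu> (Inl i))))
     * (\<Prod>j\<in>UNIV. 1 / fact (\<mu> (Inr j)))"

lemma prod_UNIV_sum:
  "(\<Prod>q\<in>UNIV. f q) = (\<Prod>i\<in>UNIV. f (Inl i)) * (\<Prod>j\<in>UNIV. f (Inr j))"
  for f :: "'n::finite + 'p::finite \<Rightarrow> 'b::comm_monoid_mult"
  by (subst UNIV_Plus_UNIV[symmetric], subst prod.Plus) auto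

lemma HA_term_eq:
  "HA_term a b c \<xi> \<eta> (m, k) = HA_coeff a b c (case_sum m k) * mpow (join \<xi> \<eta>) (case_sum m k)"
  by (simp add: HA_term_def HA_coeff_def mpow_def prod_UNIV_sum weight_def join_def prod_dividef
      prod.distrib mult_ac)

lemma bij_case_sum: "bij (\<lambda>(m, k). case_sum m k)"
  by (rule bij_betw_byWitness[where f' = "\<lambda>\<mu>. (\<mu> \<circ> Inl, \<mu> \<circ> Inr)"])
    (auto simp: fun_eq_iff split: sum.splits)

lemma HA_eq_mseries: "HA a b c \<xi> \<eta> = mseries (HA_coeff a b c) (join \<xi> \<eta>)"
  unfolding HA_def mseries_def
  by (subst infsum_reindex_bij_betw[OF bij_case_sum, symmetric])
    (auto intro!: infsum_cong simp: HA_term_eq)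

lemma HA_term_summable_iff:
  "HA_term a b c \<xi> \<eta> summable_on UNIV \<longleftrightarrow>
   (\<lambda>\<mu>. HA_coeff a b c \<mu> * mpow (join \<xi> \<eta>) \<mu>) summable_on UNIV"
  by (subst summable_on_reindex_bij_betw[OF bij_case_sum, symmetric])
    (auto intro!: summable_on_cong simp: HA_term_eq)

text \<open>Raising $m_i$ by one multiplies $(a)_w$ by $a + w$ and $(b_i)_{m_i} / (m_i!\, (c_i)_{m_i})$ by
  $(b_i + m_i) / ((m_i + 1)(c_i + m_i))$.\<close>

lemma HA_coeff_rec_Inl:
  fixes a :: complex and b c :: "complex ^ 'n::finite" and \<mu> :: "'n + 'p::finite \<Rightarrow> nat"
  assumes a: "\<And>k::nat. k \<ge> 1 \<Longrightarrow> a \<noteq> of_nat k" and c: "\<And>i (k::nat). c $ i \<noteq> - of_nat k"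
  shows "(of_nat (\<mu> (Inl i)) + c $ i) * fderiv (Inl i) (HA_coeff a b c) \<mu> =
         (of_nat (\<mu> (Inl i)) + b $ i) * ((a + of_int (weight \<mu>)) * HA_coeff a b c \<mu>)"
proof -
  define f where "f r n = pochhammer (b $ r) n / (fact n * pochhammer (c $ r) n)" for r n
  define n where "n = \<mu> (Inl i)"
  have nz: "of_nat n + c $ i \<noteq> 0"
    using c[of i n] by (metis add_eq_0_iff)
  have "(of_nat n + c $ i) * (of_nat (Suc n) * f i (Suc n)) = (of_nat n + b $ i) * f i n"
    unfolding f_def pochhammer_Suc fact_Suc using nz
    by (simp add: divide_simps add.commute del: of_nat_Suc)
  moreover have "(\<Prod>r\<in>UNIV. f r (raise (Inl i) \<mu> (Inl r))) = f i (Suc n) * (\<Prod>r\<in>UNIV-{i}. f r (\<mu> (Inl r)))"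
    using prod_raise[of f i "\<lambda>r. \<mu> (Inl r)"] by (simp add: n_def flip: raise_Inl)
  moreover have "(\<Prod>r\<in>UNIV. f r (\<mu> (Inl r))) = f i n * (\<Prod>r\<in>UNIV-{i}. f r (\<mu> (Inl r)))"
    by (simp add: n_def prod.remove[of UNIV i])
  moreover have "HA_coeff a b c \<mu> = pochhammer_int a (weight \<mu>) * (\<Prod>r\<in>UNIV. f r (\<mu> (Inl r)))
       * (\<Prod>j\<in>UNIV. 1 / fact (\<mu> (Inr j)))"
    by (simp add: HA_coeff_def f_def)
  moreover have "HA_coeff a b c (raise (Inl i) \<mu>) = (a + of_int (weight \<mu>)) * pochhammer_int a (weight \<mu>)
       * (\<Prod>r\<in>UNIV. f r (raise (Inl i) \<mu> (Inl r))) * (\<Prod>j\<in>UNIV. 1 / fact (\<mu> (Inr j)))"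
    by (simp add: HA_coeff_def f_def weight_raise pochhammer_int_plus_1[OF a])
  ultimately show ?thesis
    unfolding fderiv_def n_def[symmetric] by (simp add: mult_ac del: of_nat_Suc)
qed

text \<open>Raising $k_j$ by one divides the coefficient by $(k_j + 1)(a + w - 1)$.\<close>

lemma HA_coeff_rec_Inr:
  assumes a: "\<And>k::nat. k \<ge> 1 \<Longrightarrow> a \<noteq> of_nat k"
  shows "(a - 1 + of_int (weight \<mu>)) * fderiv (Inr j) (HA_coeff a b c) \<mu> = HA_coeff a b c \<mu>"
proof -
  let ?P = "\<Prod>r\<in>UNIV-{j}. 1 / fact (\<mu> (Inr r)) :: complex"
  define n where "n = \<mu> (Inr j)"
  define Q where "Q = (\<Prod>i\<in>UNIV. pochhammer (b $ i) (\<mu> (Inl i)) / (fact (\<mu> (Inl i)) * pochhammer (c $ i) (\<mu> (Inl i))))"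
  have "(\<Prod>r\<in>UNIV. 1 / fact (raise (Inr j) \<mu> (Inr r))) = 1 / fact (Suc n) * ?P"
    using prod_raise[of "\<lambda>_ n. 1 / fact n :: complex" j "\<lambda>r. \<mu> (Inr r)"]
    by (simp only: n_def flip: raise_Inr)
  then have 1: "HA_coeff a b c (raise (Inr j) \<mu>) = pochhammer_int a (weight \<mu> - 1) * Q * (1 / fact (Suc n) * ?P)"
    by (simp only: HA_coeff_def weight_raise Q_def) simp
  have 2: "HA_coeff a b c \<mu> = pochhammer_int a (weight \<mu>) * Q * (1 / fact n * ?P)"
    by (simp add: HA_coeff_def Q_def n_def prod.remove[of UNIV j])
  have 3: "pochhammer_int a (weight \<mu>) = (a - 1 + of_int (weight \<mu>)) * pochhammer_int a (weight \<mu> - 1)"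
    using pochhammer_int_plus_1[OF a, of "weight \<mu> - 1"] by simp
  show ?thesis
    unfolding fderiv_def 1 2 3 n_def[symmetric] fact_Suc by (simp del: of_nat_Suc)
qed

section \<open>Convergence\<close>

definition HA_domain :: "('n::finite + 'p::finite \<Rightarrow> complex) set" where
  "HA_domain = {x. (\<Sum>i\<in>UNIV. norm (x (Inl i))) < 1}"

lemma radially_open_HA_domain: "radially_open (HA_domain :: ('n::finite + 'p::finite \<Rightarrow> complex) set)"
  unfolding radially_open_def
proof (intro ballI allI)
  fix x :: "'n + 'p \<Rightarrow> complex" and q assume x: "x \<in> HA_domain"
  show "\<exists>r > norm (x q). \<forall>z. norm z \<le> r \<longrightarrow> x(q := z) \<in> HA_domain"
  proof (cases q)
    case (Inl i)
    let ?s = "\<Sum>r\<in>UNIV-{i}. norm (x (Inl r))"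
    have "norm (x q) + ?s < 1"
      using x by (simp add: HA_domain_def Inl sum.remove[of UNIV i])
    then obtain r where r: "norm (x q) < r" "r < 1 - ?s"
      using dense[of "norm (x q)" "1 - ?s"] by auto
    have "x(q := z) \<in> HA_domain" if "norm z \<le> r" for z
    proof -
      have "(\<Sum>r\<in>UNIV. norm ((x(q := z)) (Inl r))) = norm z + (\<Sum>r\<in>UNIV-{i}. norm ((x(q := z)) (Inl r)))"
        by (simp add: Inl sum.remove[of UNIV i])
      also have "(\<Sum>r\<in>UNIV-{i}. norm ((x(q := z)) (Inl r))) = ?s"
        by (intro sum.cong) (auto simp: Inl)
      finally show ?thesis using that r(2) by (simp add: HA_domain_def)
    qed
    with r(1) show ?thesis by blast
  next
    case (Inr j)
    then have "x(q := z) \<in> HA_domain" for z using x by (simp add: HA_domain_def)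
    then show ?thesis by (blast intro: less_add_one)
  qed
qed

text \<open>The ratio $|u + n| / |v + n|$ of consecutive factors tends to 1, so it is at most $t$ from some
  index $J$ on; $C$ is the largest value that the normalised quotient takes up to $J$.\<close>

lemma pochhammer_growth:
  fixes u v :: complex
  assumes t: "t > 1" and v: "\<And>k::nat. v \<noteq> - of_nat k"
  obtains C where "C \<ge> 0" "\<And>n. norm (pochhammer u n) \<le> C * t ^ n * norm (pochhammer v n)"
proof -
  \<comment> \<open>From this index on, |u| + n \<le> t (n - |v|).\<close>
  obtain J :: nat where J: "(norm u + t * norm v) / (t - 1) \<le> real J"
    using real_arch_simple by blast
  have v0: "norm (pochhammer v n) > 0" for n
    using v by (auto simp: pochhammer_eq_0_iff)
  define Q where "Q n = norm (pochhammer u n) / (t ^ n * norm (pochhammer v n))" for n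
  define C where "C = Max (Q ` {..J})"
  have QC: "Q n \<le> C" if "n \<le> J" for n
    unfolding C_def using that by (intro Max_ge) auto
  have small: "norm (pochhammer u n) \<le> C * t ^ n * norm (pochhammer v n)" if "n \<le> J" for n
    using QC[OF that] v0[of n] t by (simp add: Q_def divide_le_eq mult.assoc)
  have bound: "norm (pochhammer u n) \<le> C * t ^ n * norm (pochhammer v n)" for n
  proof (induction n)
    case 0
    show ?case by (rule small) simp
  next
    case (Suc n)
    show ?case
    proof (cases "Suc n \<le> J")
      case True
      then show ?thesis by (rule small)
    next
      case False
      then have "real J \<le> real n" by simp
      with J have "(norm u + t * norm v) / (t - 1) \<le> real n" by linarith
      then have "norm u + real n \<le> t * (real n - norm v)"
        using t by (simp add: divide_le_eq algebra_simps)
      moreover have "norm (u + of_nat n) \<le> norm u + real n"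
        using norm_triangle_ineq[of u "of_nat n"] by simp
      moreover have "real n - norm v \<le> norm (v + of_nat n)"
        using norm_triangle_ineq2[of "of_nat n" "- v"] by (simp add: add.commute)
      then have "t * (real n - norm v) \<le> t * norm (v + of_nat n)"
        using t by simp
      ultimately have "norm (u + of_nat n) \<le> t * norm (v + of_nat n)" by linarith
      then have "norm (pochhammer u n) * norm (u + of_nat n)
          \<le> (C * t ^ n * norm (pochhammer v n)) * (t * norm (v + of_nat n))"
        using order_trans[OF norm_ge_zero Suc.IH] Suc.IH by (intro mult_mono) auto
      then show ?thesis by (simp add: pochhammer_Suc norm_mult mult_ac)
    qed
  qed
  have "C \<ge> 0" using bound[of 0] order_trans[OF norm_ge_zero] by simp
  then show ?thesis using bound that by blast
qed

text \<open>For $M \ge K$ compare $(a)_{M-K}$ with $(1)_{M-K} = (M-K)! \le M!$. For $K > M$ compare $1/(1-a)_{K-M}$ with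
  $1/(K-M)! \le 1 \le M!$; the decay in $K$ that is lost here is supplied by $1/k!$ in the
  coefficients.\<close>

lemma pochhammer_int_growth:
  assumes t: "t > 1" and a: "\<And>k::nat. k \<ge> 1 \<Longrightarrow> a \<noteq> of_nat k"
  obtains C where "C \<ge> 0"
    "\<And>M K. norm (pochhammer_int a (int M - int K)) \<le> C * t ^ M * t ^ K * fact M"
proof -
  obtain C1 where C1: "C1 \<ge> 0" "\<And>n. norm (pochhammer a n) \<le> C1 * t ^ n * fact n"
  proof (rule pochhammer_growth[OF t, of 1 a])
    show "(1::complex) \<noteq> - of_nat k" for k
      by (simp add: complex_eq_iff)
  qed (auto simp flip: pochhammer_fact)
  have a': "1 - a \<noteq> - of_nat k" for k
    using a[of "Suc k"] by (auto simp: algebra_simps)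
  obtain C2 where C2: "C2 \<ge> 0" "\<And>n. fact n \<le> C2 * t ^ n * norm (pochhammer (1 - a) n)"
    by (rule pochhammer_growth[OF t a', of 1]) (auto simp flip: pochhammer_fact)
  have pow: "t ^ n \<le> t ^ M * t ^ K" if "n \<le> M + K" for n M K
    using t that by (simp flip: power_add)
  have "norm (pochhammer_int a (int M - int K)) \<le> (C1 + C2) * (t ^ M * t ^ K) * fact M" for M K
  proof (cases "K \<le> M")
    case True
    then have "norm (pochhammer_int a (int M - int K)) = norm (pochhammer a (M - K))"
      by (simp add: pochhammer_int_def nat_diff_distrib)
    also have "\<dots> \<le> C1 * t ^ (M - K) * fact (M - K)" by (rule C1)
    also have "\<dots> \<le> (C1 + C2) * (t ^ M * t ^ K) * fact M"
      using C1(1) C2(1) t pow[of "M - K" M K] by (intro mult_mono fact_mono) auto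
    finally show ?thesis .
  next
    case False
    define n where "n = K - M"
    have n: "int M - int K = - int n" "n > 0" "n \<le> M + K" using False by (auto simp: n_def)
    have p: "norm (pochhammer (1 - a) n) > 0"
      using a' by (auto simp: pochhammer_eq_0_iff)
    have "norm (pochhammer_int a (int M - int K)) = 1 / norm (pochhammer (1 - a) n)"
      using n by (simp add: pochhammer_int_def norm_divide norm_power)
    also have "\<dots> \<le> C2 * t ^ n"
      using order_trans[OF fact_ge_1 C2(2)[of n]] p by (simp add: divide_le_eq)
    also have "\<dots> \<le> (C1 + C2) * (t ^ M * t ^ K) * 1"
      using C1(1) C2(1) t pow[OF n(3)] by (simp, intro mult_mono) auto
    also have "\<dots> \<le> (C1 + C2) * (t ^ M * t ^ K) * fact M"
      using C1(1) C2(1) t by (intro mult_left_mono fact_ge_1) auto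
    finally show ?thesis .
  qed
  then show ?thesis using that[of "C1 + C2"] C1(1) C2(1) by (simp add: mult.assoc)
qed

lemma mpow_scale: "mpow (\<lambda>q. s * x q) \<mu> = s ^ (\<Sum>q\<in>UNIV. \<mu> q) * mpow x \<mu>"
  by (simp add: mpow_def power_mult_distrib prod.distrib power_sum)

lemma norm_mpow: "norm (mpow x \<mu>) = mpow (\<lambda>q. norm (x q)) \<mu>" for x :: "_ \<Rightarrow> complex"
  by (simp add: mpow_def norm_power flip: prod_norm)

text \<open>One factor $t^{|m|}$ comes from $(a)_{|m|-|k|}$, the other from the quotients
  $(b_i)_{m_i} / (c_i)_{m_i}$. The factor $1/k!$ is written as a multinomial coefficient over $|k|!$ to match
  \<open>summable_on_multinomial\<close>.\<close>

lemma HA_coeff_bound: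
  fixes a :: complex and b c :: "complex ^ 'n::finite"
  assumes t: "t > 1" and a: "\<And>k::nat. k \<ge> 1 \<Longrightarrow> a \<noteq> of_nat k"
    and c: "\<And>i (k::nat). c $ i \<noteq> - of_nat k"
  obtains C where "C \<ge> 0"
    "\<And>m (k :: 'p::finite \<Rightarrow> nat). norm (HA_coeff a b c (case_sum m k)) \<le>
       C * (((t\<^sup>2) ^ (\<Sum>i\<in>UNIV. m i) * multinom m)
          * (t ^ (\<Sum>j\<in>UNIV. k j) * (1 / fact (\<Sum>j\<in>UNIV. k j) * multinom k)))"
proof -
  obtain Ca where Ca: "Ca \<ge> 0"
    "\<And>M K. norm (pochhammer_int a (int M - int K)) \<le> Ca * t ^ M * t ^ K * fact M"
    using pochhammer_int_growth[OF t a] by blast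
  have "\<exists>C\<ge>0. \<forall>n. norm (pochhammer (b $ i) n) \<le> C * t ^ n * norm (pochhammer (c $ i) n)" for i
    using pochhammer_growth[OF t c[of i], of "b $ i"] by metis
  then obtain Cb where Cb: "\<And>i. Cb i \<ge> 0"
    "\<And>i n. norm (pochhammer (b $ i) n) \<le> Cb i * t ^ n * norm (pochhammer (c $ i) n)"
    by metis
  show ?thesis
  proof (rule that[of "Ca * (\<Prod>i\<in>UNIV. Cb i)"])
    show "Ca * (\<Prod>i\<in>UNIV. Cb i) \<ge> 0"
      using Ca(1) Cb(1) by (simp add: prod_nonneg)
    fix m :: "'n \<Rightarrow> nat" and k :: "'p \<Rightarrow> nat"
    let ?M = "\<Sum>i\<in>UNIV. m i" and ?K = "\<Sum>j\<in>UNIV. k j"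
    have "norm (pochhammer (b $ i) (m i) / (fact (m i) * pochhammer (c $ i) (m i))) \<le> Cb i * t ^ m i / fact (m i)" for i
    proof -
      have "norm (pochhammer (c $ i) (m i)) > 0"
        using c[of i] by (auto simp: pochhammer_eq_0_iff)
      then show ?thesis
        using Cb(2)[of i "m i"] by (simp add: norm_divide norm_mult divide_simps mult_ac)
    qed
    then have "norm (\<Prod>i\<in>UNIV. pochhammer (b $ i) (m i) / (fact (m i) * pochhammer (c $ i) (m i)))
        \<le> (\<Prod>i\<in>UNIV. Cb i * t ^ m i / fact (m i))"
      unfolding prod_norm[symmetric] by (intro prod_mono) auto
    also have "\<dots> = (\<Prod>i\<in>UNIV. Cb i) * t ^ ?M / (\<Prod>i\<in>UNIV. fact (m i))"
      by (simp add: prod_dividef prod.distrib power_sum)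
    finally have 1: "norm (\<Prod>i\<in>UNIV. pochhammer (b $ i) (m i) / (fact (m i) * pochhammer (c $ i) (m i)))
        \<le> (\<Prod>i\<in>UNIV. Cb i) * t ^ ?M / (\<Prod>i\<in>UNIV. fact (m i))" .
    have "norm (HA_coeff a b c (case_sum m k)) =
        norm (pochhammer_int a (int ?M - int ?K))
        * norm (\<Prod>i\<in>UNIV. pochhammer (b $ i) (m i) / (fact (m i) * pochhammer (c $ i) (m i)))
        * (1 / (\<Prod>j\<in>UNIV. fact (k j)))"
      by (simp add: HA_coeff_def weight_def norm_mult norm_divide prod_dividef flip: prod_norm)
    also have "\<dots> \<le> (Ca * t ^ ?M * t ^ ?K * fact ?M) * ((\<Prod>i\<in>UNIV. Cb i) * t ^ ?M / (\<Prod>i\<in>UNIV. fact (m i)))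
        * (1 / (\<Prod>j\<in>UNIV. fact (k j)))"
      by (intro mult_mono Ca(2) 1 mult_nonneg_nonneg divide_nonneg_nonneg prod_nonneg)
        (use Ca(1) Cb(1) t in auto)
    also have "\<dots> = Ca * (\<Prod>i\<in>UNIV. Cb i) * (((t\<^sup>2) ^ ?M * multinom m)
          * (t ^ ?K * (1 / fact ?K * multinom k)))"
      by (simp add: multinom_def power2_eq_square power_mult_distrib)
    finally show "norm (HA_coeff a b c (case_sum m k)) \<le> Ca * (\<Prod>i\<in>UNIV. Cb i) * (((t\<^sup>2) ^ ?M * multinom m)
          * (t ^ ?K * (1 / fact ?K * multinom k)))" .
  qed
qed

lemma HA_term_summable:
  fixes a :: complex and b c \<xi> :: "complex ^ 'n::finite" and \<eta> :: "complex ^ 'p::finite"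
  assumes a: "\<And>k::nat. k \<ge> 1 \<Longrightarrow> a \<noteq> of_nat k"
    and c: "\<And>i (k::nat). c $ i \<noteq> - of_nat k"
    and s: "(\<Sum>i\<in>UNIV. norm (\<xi> $ i)) < 1"
  shows "HA_term a b c \<xi> \<eta> summable_on UNIV"
proof -
  define s where "s = (\<Sum>i\<in>UNIV. norm (\<xi> $ i))"
  \<comment> \<open>Any t > 1 with t^2 s < 1 would do; here t^2 s < 1 amounts to 0 < (1 - s)^2.\<close>
  define t where "t = 2 / (1 + s)"
  have s0: "0 \<le> s" "s < 1" using assms(3) by (auto simp: s_def sum_nonneg)
  then have t: "t > 1" by (simp add: t_def)
  have "t\<^sup>2 * s = 4 * s / (1 + s)\<^sup>2" by (simp add: t_def power_divide)
  also have "\<dots> < 1"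
  proof -
    have "(1 - s)\<^sup>2 > 0" using s0 by simp
    then have "4 * s < (1 + s)\<^sup>2" by (simp add: power2_eq_square algebra_simps)
    then show ?thesis using s0 by simp
  qed
  finally have ts: "t\<^sup>2 * s < 1" .
  obtain C where C: "C \<ge> 0"
    "\<And>m (k :: 'p \<Rightarrow> nat). norm (HA_coeff a b c (case_sum m k)) \<le>
       C * (((t\<^sup>2) ^ (\<Sum>i\<in>UNIV. m i) * multinom m)
          * (t ^ (\<Sum>j\<in>UNIV. k j) * (1 / fact (\<Sum>j\<in>UNIV. k j) * multinom k)))"
    using HA_coeff_bound[OF t a c, where b = b] by blast
  define E where "E m = multinom m * mpow (\<lambda>i. t\<^sup>2 * norm (\<xi> $ i)) m" for m
  define F where "F k = 1 / fact (\<Sum>j\<in>UNIV. k j) * multinom k * mpow (\<lambda>j. t * norm (\<eta> $ j)) k" for k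
  have E0: "E m \<ge> 0" and F0: "F k \<ge> 0" for m k
    unfolding E_def F_def mpow_def using t
    by (auto intro!: prod_nonneg mult_nonneg_nonneg divide_nonneg_nonneg less_imp_le[OF multinom_pos])
  have "E summable_on UNIV"
  proof -
    have "summable (\<lambda>N. (t\<^sup>2 * s) ^ N)"
      using ts s0 by (intro summable_geometric) auto
    then show ?thesis
      using summable_on_multinomial[of "\<lambda>i. t\<^sup>2 * norm (\<xi> $ i)" "\<lambda>_. 1"]
      by (simp add: E_def[abs_def] s_def sum_distrib_left)
  qed
  have "F summable_on UNIV"
    unfolding F_def
  proof (rule summable_on_multinomial)
    show "summable (\<lambda>N. 1 / fact N * (\<Sum>j\<in>UNIV. t * norm (\<eta> $ j)) ^ N)"
      using summable_exp by (simp add: inverse_eq_divide)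
  qed (use t in auto)
  have "(\<lambda>(m, k). E m * F k) summable_on UNIV \<times> UNIV"
  proof (rule summable_on_SigmaI)
    show "((\<lambda>k. case (m, k) of (m, k) \<Rightarrow> E m * F k) has_sum (E m * (\<Sum>\<^sub>\<infinity>k. F k))) UNIV" for m
      using \<open>F summable_on UNIV\<close> by (auto intro!: has_sum_cmult_right)
    show "(\<lambda>m. E m * (\<Sum>\<^sub>\<infinity>k. F k)) summable_on UNIV"
      using \<open>E summable_on UNIV\<close> by (rule summable_on_cmult_left)
  qed (use E0 F0 in auto)
  then have "(\<lambda>mk. C * (case mk of (m, k) \<Rightarrow> E m * F k)) summable_on UNIV"
    by (intro summable_on_cmult_right) simp
  then have "(\<lambda>mk. norm (HA_term a b c \<xi> \<eta> mk)) summable_on UNIV"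
  proof (rule Infinite_Sum.abs_summable_on_comparison_test')
    fix mk :: "('n \<Rightarrow> nat) \<times> ('p \<Rightarrow> nat)"
    obtain m k where mk: "mk = (m, k)" by force
    have "norm (HA_term a b c \<xi> \<eta> mk) = norm (HA_coeff a b c (case_sum m k))
        * (mpow (\<lambda>i. norm (\<xi> $ i)) m * mpow (\<lambda>j. norm (\<eta> $ j)) k)"
      by (simp add: mk HA_term_eq norm_mult norm_mpow) (simp add: mpow_def prod_UNIV_sum)
    also have "\<dots> \<le> (C * (((t\<^sup>2) ^ (\<Sum>i\<in>UNIV. m i) * multinom m)
          * (t ^ (\<Sum>j\<in>UNIV. k j) * (1 / fact (\<Sum>j\<in>UNIV. k j) * multinom k))))
        * (mpow (\<lambda>i. norm (\<xi> $ i)) m * mpow (\<lambda>j. norm (\<eta> $ j)) k)"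
      by (intro mult_right_mono C(2)) (auto simp: mpow_def intro!: mult_nonneg_nonneg prod_nonneg)
    also have "\<dots> = C * (E m * F k)"
      by (simp add: E_def F_def mpow_scale)
    finally show "norm (HA_term a b c \<xi> \<eta> mk) \<le> C * (case mk of (m, k) \<Rightarrow> E m * F k)"
      by (simp add: mk)
  qed
  then show ?thesis
    by (simp add: summable_on_iff_abs_summable_on_complex)
qed

lemma converges_on_HA_coeff:
  fixes a :: complex and b c :: "complex ^ 'n::finite"
  assumes a: "\<And>k::nat. k \<ge> 1 \<Longrightarrow> a \<noteq> of_nat k"
    and c: "\<And>i (k::nat). c $ i \<noteq> - of_nat k"
  shows "converges_on (HA_domain :: ('n + 'p::finite \<Rightarrow> complex) set) (HA_coeff a b c)"
  unfolding converges_on_def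
proof
  fix x :: "'n + 'p \<Rightarrow> complex" assume x: "x \<in> HA_domain"
  have "join (\<chi> i. x (Inl i)) (\<chi> j. x (Inr j)) = x"
    by (auto simp: fun_eq_iff join_def split: sum.splits)
  moreover have "HA_term a b c (\<chi> i. x (Inl i)) (\<chi> j. x (Inr j)) summable_on UNIV"
    by (rule HA_term_summable[OF a c]) (use x in \<open>auto simp: HA_domain_def\<close>)
  ultimately show "(\<lambda>\<mu>. HA_coeff a b c \<mu> * mpow x \<mu>) summable_on UNIV"
    by (simp add: HA_term_summable_iff)
qed

section \<open>The differential equations\<close>

text \<open>Both sides are power series in $x$ with equal coefficients by \<open>HA_coeff_rec_Inl\<close>. On the right
  the series $W$ of $(a + \theta)\omega$ is formed first; differentiating it in $\xi_i$ raises the weight by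
  one, which is where $a + 1$ comes from.\<close>

lemma HA_series_equation_Inl:
  fixes a :: complex and b c :: "complex ^ 'n::finite" and x :: "'n + 'p::finite \<Rightarrow> complex" and i :: 'n and A B
  assumes a: "\<And>k::nat. k \<ge> 1 \<Longrightarrow> a \<noteq> of_nat k"
    and c: "\<And>i (k::nat). c $ i \<noteq> - of_nat k" and x: "x \<in> HA_domain"
  defines "A \<equiv> HA_coeff a b c" and "B \<equiv> fderiv (Inl i) A"
  shows "x (Inl i) * mseries (fderiv (Inl i) B) x + c $ i * mseries B x
       = x (Inl i) * ((a + 1) * mseries B x + euler B x) + b $ i * (a * mseries A x + euler A x)"
proof -
  let ?q = "Inl i :: 'n + 'p"
  note X = radially_open_HA_domain
  have A: "converges_on HA_domain A"
    unfolding A_def by (rule converges_on_HA_coeff[OF a c])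
  have B: "converges_on HA_domain B"
    unfolding B_def by (rule converges_on_fderiv[OF X A])
  define W where "W \<mu> = (a + of_int (weight \<mu>)) * A \<mu>" for \<mu>
  have Wsum: "((\<lambda>\<mu>. W \<mu> * mpow y \<mu>) has_sum (a * mseries A y + euler A y)) UNIV" if "y \<in> HA_domain" for y
    unfolding W_def using has_sum_weight[OF X A that] .
  then have W: "converges_on HA_domain W"
    by (auto simp: converges_on_def summable_on_def)
  have "fderiv ?q W = (\<lambda>\<mu>. (a + 1 + of_int (weight \<mu>)) * B \<mu>)"
    by (simp add: fderiv_def W_def B_def weight_raise fun_eq_iff add_ac)
  then have dW: "mseries (fderiv ?q W) x = (a + 1) * mseries B x + euler B x"
    using has_sum_weight[OF X B x, of "a + 1"] by (simp add: mseries_def infsumI)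
  have "((\<lambda>\<mu>. (of_nat (\<mu> ?q) * W \<mu> * mpow x \<mu>) + b $ i * (W \<mu> * mpow x \<mu>)) has_sum
      (x ?q * ((a + 1) * mseries B x + euler B x) + b $ i * (a * mseries A x + euler A x))) UNIV"
    unfolding dW[symmetric]
    by (intro has_sum_add has_sum_cmult_right Wsum x has_sum_euler[OF X W])
  moreover have "((\<lambda>\<mu>. (of_nat (\<mu> ?q) * B \<mu> * mpow x \<mu>) + c $ i * (B \<mu> * mpow x \<mu>)) has_sum
      (x ?q * mseries (fderiv ?q B) x + c $ i * mseries B x)) UNIV"
    by (intro has_sum_add has_sum_cmult_right mseries_has_sum[OF B x] has_sum_euler[OF X B x])
  moreover have "of_nat (\<mu> ?q) * B \<mu> * mpow x \<mu> + c $ i * (B \<mu> * mpow x \<mu>)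
      = of_nat (\<mu> ?q) * W \<mu> * mpow x \<mu> + b $ i * (W \<mu> * mpow x \<mu>)" for \<mu>
  proof -
    have "(of_nat (\<mu> ?q) + c $ i) * B \<mu> = (of_nat (\<mu> ?q) + b $ i) * W \<mu>"
      unfolding A_def B_def W_def by (rule HA_coeff_rec_Inl[OF a c])
    then have "(of_nat (\<mu> ?q) + c $ i) * B \<mu> * mpow x \<mu> = (of_nat (\<mu> ?q) + b $ i) * W \<mu> * mpow x \<mu>"
      by simp
    then show ?thesis by (simp add: algebra_simps)
  qed
  ultimately show ?thesis
    by (simp add: has_sum_unique)
qed

lemma HA_series_equation_Inr:
  fixes a :: complex and b c :: "complex ^ 'n::finite" and x :: "'n + 'p::finite \<Rightarrow> complex" and j :: 'p and A B
  assumes a: "\<And>k::nat. k \<ge> 1 \<Longrightarrow> a \<noteq> of_nat k"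
    and c: "\<And>i (k::nat). c $ i \<noteq> - of_nat k" and x: "x \<in> HA_domain"
  defines "A \<equiv> HA_coeff a b c" and "B \<equiv> fderiv (Inr j) A"
  shows "(a - 1) * mseries B x + euler B x = mseries A x"
proof -
  have A: "converges_on HA_domain A"
    unfolding A_def by (rule converges_on_HA_coeff[OF a c])
  have B: "converges_on HA_domain B"
    unfolding B_def by (rule converges_on_fderiv[OF radially_open_HA_domain A])
  have "(a - 1 + of_int (weight \<mu>)) * B \<mu> = A \<mu>" for \<mu>
    unfolding A_def B_def by (rule HA_coeff_rec_Inr[OF a])
  then have "((\<lambda>\<mu>. A \<mu> * mpow x \<mu>) has_sum ((a - 1) * mseries B x + euler B x)) UNIV"
    using has_sum_weight[OF radially_open_HA_domain B x, of "a - 1"] by simp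
  then show ?thesis
    by (simp add: mseries_def infsumI)
qed

theorem mainTheorem1:
  fixes a :: complex
    and b c :: "complex ^ 'n::finite"
    and \<omega> :: "complex ^ 'n \<Rightarrow> complex ^ 'p::finite \<Rightarrow> complex"
  assumes a: "\<And>k::nat. k \<ge> 1 \<Longrightarrow> a \<noteq> of_nat k"
    and c: "\<And>i (k::nat). c $ i \<noteq> - of_nat k"
    and \<omega>: "\<omega> = HA a b c"
  shows "\<forall>(\<xi> :: complex ^ 'n) (\<eta> :: complex ^ 'p). (\<Sum>i\<in>UNIV. norm (\<xi> $ i)) < 1 \<longrightarrow>
     HA_term a b c \<xi> \<eta> summable_on UNIV \<and>
     has_partials_upto_2 \<omega> \<xi> \<eta> \<and>
     (\<forall>i. \<xi> $ i * (1 - \<xi> $ i) * D\<xi> i (D\<xi> i \<omega>) \<xi> \<eta>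
        - \<xi> $ i * (\<Sum>j\<in>UNIV - {i}. \<xi> $ j * D\<xi> j (D\<xi> i \<omega>) \<xi> \<eta>)
        + \<xi> $ i * (\<Sum>j\<in>UNIV. \<eta> $ j * D\<eta> j (D\<xi> i \<omega>) \<xi> \<eta>)
        + (c $ i - (a + b $ i + 1) * \<xi> $ i) * D\<xi> i \<omega> \<xi> \<eta>
        - b $ i * (\<Sum>j\<in>UNIV - {i}. \<xi> $ j * D\<xi> j \<omega> \<xi> \<eta>)
        + b $ i * (\<Sum>j\<in>UNIV. \<eta> $ j * D\<eta> j \<omega> \<xi> \<eta>)
        - a * b $ i * \<omega> \<xi> \<eta> = 0) \<and>
     (\<forall>j. (\<Sum>l\<in>UNIV. \<eta> $ l * D\<eta> j (D\<eta> l \<omega>) \<xi> \<eta>)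
        - (\<Sum>l\<in>UNIV. \<xi> $ l * D\<eta> j (D\<xi> l \<omega>) \<xi> \<eta>)
        + (1 - a) * D\<eta> j \<omega> \<xi> \<eta>
        + \<omega> \<xi> \<eta> = 0)"
proof (intro allI impI)
  fix \<xi> :: "complex ^ 'n" and \<eta> :: "complex ^ 'p"
  assume s: "(\<Sum>i\<in>UNIV. norm (\<xi> $ i)) < 1"
  let ?X = "HA_domain :: ('n + 'p \<Rightarrow> complex) set"
  define x where "x = join \<xi> \<eta>"
  define A :: "('n + 'p \<Rightarrow> nat) \<Rightarrow> complex" where "A = HA_coeff a b c"
  have x: "join \<xi> \<eta> \<in> ?X" using s by (simp add: HA_domain_def)
  have x': "x \<in> ?X" using x by (simp add: x_def)
  have conv: "converges_on ?X A"
    unfolding A_def by (rule converges_on_HA_coeff[OF a c])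
  have rep: "represents ?X A \<omega>"
    by (simp add: represents_def \<omega> A_def HA_eq_mseries)
  note rep1 = represents_D[OF radially_open_HA_domain conv rep]
  note rep2 = represents_D[OF radially_open_HA_domain converges_on_fderiv[OF radially_open_HA_domain conv]]
  have val: "f \<xi> \<eta> = mseries G x" if "represents ?X G f" for f G
    using that x by (simp add: represents_def x_def)
  note vals = val[OF rep] val[OF rep1(1)] val[OF rep1(2)]
    val[OF rep2(1)[OF rep1(1)]] val[OF rep2(2)[OF rep1(1)]] val[OF rep2(2)[OF rep1(2)]]
  have coord: "\<xi> $ i = x (Inl i)" "\<eta> $ j = x (Inr j)" for i j
    by (simp_all add: x_def)
  have split_off_i: "(\<Sum>r\<in>UNIV. x (Inl r) * mseries (fderiv (Inl r) G) x) =
      x (Inl i) * mseries (fderiv (Inl i) G) x + (\<Sum>r\<in>UNIV-{i}. x (Inl r) * mseries (fderiv (Inl r) G) x)"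
    for G i
    by (simp add: sum.remove[of UNIV i])
  have pde1: "\<xi> $ i * (1 - \<xi> $ i) * D\<xi> i (D\<xi> i \<omega>) \<xi> \<eta>
        - \<xi> $ i * (\<Sum>j\<in>UNIV - {i}. \<xi> $ j * D\<xi> j (D\<xi> i \<omega>) \<xi> \<eta>)
        + \<xi> $ i * (\<Sum>j\<in>UNIV. \<eta> $ j * D\<eta> j (D\<xi> i \<omega>) \<xi> \<eta>)
        + (c $ i - (a + b $ i + 1) * \<xi> $ i) * D\<xi> i \<omega> \<xi> \<eta>
        - b $ i * (\<Sum>j\<in>UNIV - {i}. \<xi> $ j * D\<xi> j \<omega> \<xi> \<eta>)
        + b $ i * (\<Sum>j\<in>UNIV. \<eta> $ j * D\<eta> j \<omega> \<xi> \<eta>)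
        - a * b $ i * \<omega> \<xi> \<eta> = 0" for i
    using HA_series_equation_Inl[OF a c x', where b = b and i = i]
    unfolding vals coord euler_def split_off_i[of _ i] A_def[symmetric]
    by (simp add: algebra_simps)
  \<comment> \<open>Here the fixed variable is differentiated last; exchanging the derivatives turns the sums
    into the Euler operator applied to the first derivative.\<close>
  have pde2: "(\<Sum>l\<in>UNIV. \<eta> $ l * D\<eta> j (D\<eta> l \<omega>) \<xi> \<eta>)
        - (\<Sum>l\<in>UNIV. \<xi> $ l * D\<eta> j (D\<xi> l \<omega>) \<xi> \<eta>)
        + (1 - a) * D\<eta> j \<omega> \<xi> \<eta> + \<omega> \<xi> \<eta> = 0" for j
    using HA_series_equation_Inr[OF a c x', where b = b and j = j]
    unfolding vals coord euler_def A_def[symmetric] fderiv_commute[of "Inr j"]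
    by (simp add: algebra_simps)
  show "HA_term a b c \<xi> \<eta> summable_on UNIV \<and>
     has_partials_upto_2 \<omega> \<xi> \<eta> \<and>
     (\<forall>i. \<xi> $ i * (1 - \<xi> $ i) * D\<xi> i (D\<xi> i \<omega>) \<xi> \<eta>
        - \<xi> $ i * (\<Sum>j\<in>UNIV - {i}. \<xi> $ j * D\<xi> j (D\<xi> i \<omega>) \<xi> \<eta>)
        + \<xi> $ i * (\<Sum>j\<in>UNIV. \<eta> $ j * D\<eta> j (D\<xi> i \<omega>) \<xi> \<eta>)
        + (c $ i - (a + b $ i + 1) * \<xi> $ i) * D\<xi> i \<omega> \<xi> \<eta>
        - b $ i * (\<Sum>j\<in>UNIV - {i}. \<xi> $ j * D\<xi> j \<omega> \<xi> \<eta>)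
        + b $ i * (\<Sum>j\<in>UNIV. \<eta> $ j * D\<eta> j \<omega> \<xi> \<eta>)
        - a * b $ i * \<omega> \<xi> \<eta> = 0) \<and>
     (\<forall>j. (\<Sum>l\<in>UNIV. \<eta> $ l * D\<eta> j (D\<eta> l \<omega>) \<xi> \<eta>)
        - (\<Sum>l\<in>UNIV. \<xi> $ l * D\<eta> j (D\<xi> l \<omega>) \<xi> \<eta>)
        + (1 - a) * D\<eta> j \<omega> \<xi> \<eta>
        + \<omega> \<xi> \<eta> = 0)"
    by (intro conjI allI HA_term_summable[OF a c s] pde1 pde2
        represents_partials_upto_2[OF radially_open_HA_domain conv rep x])
qed

end
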